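(* Let $1\le k<n$ and let $(V,\mathcal{H})$ be a $k$-hypergraph with $n=|V|$ vertices. Then $(V,\mathcal{H})$ is $2$-monotone if and only if it is not exchangeable, that is, if and only if for all $E_1,E_2\in\mathcal{H}$ and all $v_1\in E_1\setminus E_2$, $v_2\in E_2\setminus E_1$, either $(E_1\setminus\{v_1\})\cup\{v_2\}\in\mathcal{H}$ or $(E_2\setminus\{v_2\})\cup\{v_1\}\in\mathcal{H}$.
   Context: A $k$-hypergraph is a pair $(V,\mathcal{H})$ with $V$ a finite set and $\mathcal{H}\subseteq\binom{V}{k}$ a set of $k$-element subsets of $V$; $\overline{\mathcal{H}}:=\binom{V}{k}\setminus\mathcal{H}$. Exchangeable: there are $E_1,E_2\in\mathcal{H}$, $v_1\in E_1\setminus E_2$ and $v_2\in E_2\setminus E_1$ such that $(E_1\setminus\{v_1\})\cup\{v_2\}\in\overline{\mathcal{H}}$ and $(E_2\setminus\{v_2\})\cup\{v_1\}\in\overline{\mathcal{H}}$. (Uniform) monotonicity: for $R_1,R_2\subseteq V$ with $|R_1|=|R_2|$, write $R_1\le R_2$ if for all $S\subseteq V\setminus(R_1\cup R_2)$, $S\cup R_1\in\mathcal{H}$ implies $S\cup R_2\in\mathcal{H}$. The hypergraph is $r$-monotone if for all $R_1,R_2\subseteq V$ with $|R_1|=|R_2|$ and $|R_1\cup R_2|\le r$, either $R_1\le R_2$ or $R_2\le R_1$. "Either ... or" is inclusive. *)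

theory Defs
  imports "HOL-Library.Ramsey"
begin

(* nsets V k, written [V]^k, is the library's set of k-element subsets of V. *)

definition k_hypergraph :: "nat \<Rightarrow> 'a set \<Rightarrow> 'a set set \<Rightarrow> bool" where
  "k_hypergraph k V H \<longleftrightarrow> finite V \<and> H \<subseteq> nsets V k"

definition co_edges :: "nat \<Rightarrow> 'a set \<Rightarrow> 'a set set \<Rightarrow> 'a set set" where
  "co_edges k V H = nsets V k - H"

definition exchangeable :: "nat \<Rightarrow> 'a set \<Rightarrow> 'a set set \<Rightarrow> bool" where
  "exchangeable k V H \<longleftrightarrow>
     (\<exists>E1\<in>H. \<exists>E2\<in>H. \<exists>v1\<in>E1 - E2. \<exists>v2\<in>E2 - E1.
        (E1 - {v1}) \<union> {v2} \<in> co_edges k V H \<and> (E2 - {v2}) \<union> {v1} \<in> co_edges k V H)"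

(* The relation R1 \<le> R2; it is only meant for subsets of V of equal cardinality,
   a restriction imposed where it is used. *)
definition swap_le :: "'a set \<Rightarrow> 'a set set \<Rightarrow> 'a set \<Rightarrow> 'a set \<Rightarrow> bool" where
  "swap_le V H R1 R2 \<longleftrightarrow>
     (\<forall>S. S \<subseteq> V - (R1 \<union> R2) \<longrightarrow> S \<union> R1 \<in> H \<longrightarrow> S \<union> R2 \<in> H)"

definition monotone_hypergraph :: "nat \<Rightarrow> 'a set \<Rightarrow> 'a set set \<Rightarrow> bool" where
  "monotone_hypergraph r V H \<longleftrightarrow>
     (\<forall>R1 R2. R1 \<subseteq> V \<longrightarrow> R2 \<subseteq> V \<longrightarrow> card R1 = card R2 \<longrightarrow> card (R1 \<union> R2) \<le> r \<longrightarrow>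
        swap_le V H R1 R2 \<or> swap_le V H R2 R1)"

end

theory Submission
  imports Defs
begin

text \<open>
  Two distinct sets of equal size whose union has at most two elements must be singletons, so
  2-monotonicity says that any two vertices \<open>x\<close>, \<open>y\<close> are comparable
  (\<open>monotone_hypergraph_2_iff\<close>). The relation \<open>swap_le V H {x} {y}\<close> says that replacing
  \<open>x\<close> by \<open>y\<close> in an edge that contains \<open>x\<close> but not \<open>y\<close> gives an edge again
  (\<open>swap_le_singletons_iff\<close>). Two incomparable vertices are therefore the same thing as an edge
  \<open>E1\<close> that is spoiled by replacing \<open>x\<close> by \<open>y\<close> together with an edge \<open>E2\<close> that is
  spoiled by replacing \<open>y\<close> by \<open>x\<close>, which is what the exchange condition forbids. Since
  such a replacement keeps the number of vertices, a spoiled edge is an element of the complementary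
  hypergraph, and so the exchange condition fails precisely for exchangeable hypergraphs.
\<close>

text \<open>The sets \<open>S\<close> in the definition of the relation are the sets \<open>E - {x}\<close> for edges
  \<open>E\<close> through \<open>x\<close> that avoid \<open>y\<close>.\<close>

lemma swap_le_singletons_iff:
  assumes "H \<subseteq> Pow V" and "x \<noteq> y"
  shows "swap_le V H {x} {y} \<longleftrightarrow> (\<forall>E\<in>H. x \<in> E \<longrightarrow> y \<notin> E \<longrightarrow> (E - {x}) \<union> {y} \<in> H)"
proof
  assume le: "swap_le V H {x} {y}"
  show "\<forall>E\<in>H. x \<in> E \<longrightarrow> y \<notin> E \<longrightarrow> (E - {x}) \<union> {y} \<in> H"
  proof (intro ballI impI)
    fix E assume E: "E \<in> H" "x \<in> E" "y \<notin> E"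
    then have "E - {x} \<subseteq> V - ({x} \<union> {y})" and "(E - {x}) \<union> {x} \<in> H"
      using assms(1) by (auto simp: insert_absorb)
    then show "(E - {x}) \<union> {y} \<in> H"
      using le unfolding swap_le_def by blast
  qed
next
  assume swap: "\<forall>E\<in>H. x \<in> E \<longrightarrow> y \<notin> E \<longrightarrow> (E - {x}) \<union> {y} \<in> H"
  show "swap_le V H {x} {y}"
    unfolding swap_le_def
  proof (intro allI impI)
    fix S assume S: "S \<subseteq> V - ({x} \<union> {y})" "S \<union> {x} \<in> H"
    then have "(S \<union> {x}) - {x} = S" and "y \<notin> S \<union> {x}"
      using assms(2) by auto
    then show "S \<union> {y} \<in> H"
      using swap S(2) by (metis UnI2 singletonI)
  qed
qed

lemma monotone_hypergraph_2_iff: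
  assumes "finite V"
  shows "monotone_hypergraph 2 V H \<longleftrightarrow>
    (\<forall>x\<in>V. \<forall>y\<in>V. x \<noteq> y \<longrightarrow> swap_le V H {x} {y} \<or> swap_le V H {y} {x})"
proof
  assume "monotone_hypergraph 2 V H"
  then show "\<forall>x\<in>V. \<forall>y\<in>V. x \<noteq> y \<longrightarrow> swap_le V H {x} {y} \<or> swap_le V H {y} {x}"
    unfolding monotone_hypergraph_def by simp
next
  assume comparable:
    "\<forall>x\<in>V. \<forall>y\<in>V. x \<noteq> y \<longrightarrow> swap_le V H {x} {y} \<or> swap_le V H {y} {x}"
  show "monotone_hypergraph 2 V H"
    unfolding monotone_hypergraph_def
  proof (intro allI impI)
    fix R1 R2
    assume R: "R1 \<subseteq> V" "R2 \<subseteq> V" "card R1 = card R2" "card (R1 \<union> R2) \<le> 2"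
    then have fin: "finite R1" "finite R2"
      using assms finite_subset by auto
    show "swap_le V H R1 R2 \<or> swap_le V H R2 R1"
    proof (cases "R1 = R2")
      case True
      then show ?thesis by (simp add: swap_le_def)
    next
      case False
      \<comment> \<open>Distinct finite sets of equal size are not nested, so \<open>R1\<close> is a proper subset of the union.\<close>
      then have "R1 \<subset> R1 \<union> R2"
        using R(3) fin by (metis card_subset_eq psubsetI sup.cobounded1 sup.cobounded2)
      then have "card R1 < 2"
        using R(4) fin psubset_card_mono[of "R1 \<union> R2" R1] by simp
      moreover have "card R1 \<noteq> 0"
        using False R(3) fin by auto
      ultimately have "card R1 = 1" and "card R2 = 1"
        using R(3) by auto
      then obtain x y where "R1 = {x}" "R2 = {y}"
        by (metis card_1_singletonE)
      then show ?thesis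
        using comparable R(1,2) False by simp
    qed
  qed
qed

lemma monotone_hypergraph_2_iff_exchange:
  assumes "finite V" and "H \<subseteq> Pow V"
  shows "monotone_hypergraph 2 V H \<longleftrightarrow>
    (\<forall>E1\<in>H. \<forall>E2\<in>H. \<forall>v1\<in>E1 - E2. \<forall>v2\<in>E2 - E1.
       (E1 - {v1}) \<union> {v2} \<in> H \<or> (E2 - {v2}) \<union> {v1} \<in> H)" (is "_ \<longleftrightarrow> ?exchange")
proof -
  define swaps where
    "swaps x y \<longleftrightarrow> (\<forall>E\<in>H. x \<in> E \<longrightarrow> y \<notin> E \<longrightarrow> (E - {x}) \<union> {y} \<in> H)" for x y
  have "monotone_hypergraph 2 V H \<longleftrightarrow>
      (\<forall>x\<in>V. \<forall>y\<in>V. x \<noteq> y \<longrightarrow> swaps x y \<or> swaps y x)"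
    using assms by (simp add: monotone_hypergraph_2_iff swap_le_singletons_iff swaps_def)
  also have "\<dots> \<longleftrightarrow> ?exchange"
  proof
    assume comparable: "\<forall>x\<in>V. \<forall>y\<in>V. x \<noteq> y \<longrightarrow> swaps x y \<or> swaps y x"
    show ?exchange
    proof (intro ballI)
      fix E1 E2 v1 v2
      assume E: "E1 \<in> H" "E2 \<in> H" "v1 \<in> E1 - E2" "v2 \<in> E2 - E1"
      then have "v1 \<in> V" "v2 \<in> V" "v1 \<noteq> v2"
        using assms(2) by auto
      then have "swaps v1 v2 \<or> swaps v2 v1"
        using comparable by blast
      then show "(E1 - {v1}) \<union> {v2} \<in> H \<or> (E2 - {v2}) \<union> {v1} \<in> H"
        using E unfolding swaps_def by blast
    qed
  next
    assume exchange: ?exchange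
    show "\<forall>x\<in>V. \<forall>y\<in>V. x \<noteq> y \<longrightarrow> swaps x y \<or> swaps y x"
    proof (intro ballI impI, rule ccontr)
      fix x y assume "\<not> (swaps x y \<or> swaps y x)"
      then obtain E1 E2
        where "E1 \<in> H" "x \<in> E1" "y \<notin> E1" "(E1 - {x}) \<union> {y} \<notin> H"
          and "E2 \<in> H" "y \<in> E2" "x \<notin> E2" "(E2 - {y}) \<union> {x} \<notin> H"
        unfolding swaps_def by blast
      then show False
        using exchange by blast
    qed
  qed
  finally show ?thesis .
qed

lemma swap_in_nsets:
  assumes "E \<in> nsets V k" and "x \<in> E" and "y \<in> V - E"
  shows "(E - {x}) \<union> {y} \<in> nsets V k"
proof -
  have "finite E" "E \<subseteq> V" "card E = k"
    using assms(1) by (auto simp: nsets_def)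
  moreover have "card ((E - {x}) \<union> {y}) = card E"
    using assms(2,3) \<open>finite E\<close> card_Suc_Diff1[of E x] by simp
  ultimately show ?thesis
    using assms(3) by (auto simp: nsets_def)
qed

lemma not_exchangeable_iff:
  assumes "k_hypergraph k V H"
  shows "\<not> exchangeable k V H \<longleftrightarrow>
    (\<forall>E1\<in>H. \<forall>E2\<in>H. \<forall>v1\<in>E1 - E2. \<forall>v2\<in>E2 - E1.
       (E1 - {v1}) \<union> {v2} \<in> H \<or> (E2 - {v2}) \<union> {v1} \<in> H)"
proof -
  have edges: "E \<in> nsets V k" "E \<subseteq> V" if "E \<in> H" for E
    using assms that by (auto simp: k_hypergraph_def nsets_def)
  have spoiled: "(E - {x}) \<union> {y} \<in> co_edges k V H \<longleftrightarrow> (E - {x}) \<union> {y} \<notin> H"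
    if "E \<in> H" "F \<in> H" "x \<in> E - F" "y \<in> F - E" for E F x y
  proof -
    have "y \<in> V - E"
      using edges(2)[OF that(2)] that(4) by blast
    then have "(E - {x}) \<union> {y} \<in> nsets V k"
      using swap_in_nsets edges(1)[OF that(1)] that(3) by fast
    then show ?thesis
      unfolding co_edges_def by simp
  qed
  have "exchangeable k V H \<longleftrightarrow>
      (\<exists>E1\<in>H. \<exists>E2\<in>H. \<exists>v1\<in>E1 - E2. \<exists>v2\<in>E2 - E1.
         (E1 - {v1}) \<union> {v2} \<notin> H \<and> (E2 - {v2}) \<union> {v1} \<notin> H)"
    unfolding exchangeable_def
    by (intro bex_cong refl arg_cong2[where f = conj] spoiled)
  then show ?thesis
    by simp
qed

theorem proposition7p1:
  fixes V :: "'a set" and H :: "'a set set" and k n :: nat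
  assumes "1 \<le> k" and "k < n"
    and "k_hypergraph k V H"
    and "card V = n"
  shows "(monotone_hypergraph 2 V H \<longleftrightarrow> \<not> exchangeable k V H) \<and>
    (monotone_hypergraph 2 V H \<longleftrightarrow>
      (\<forall>E1\<in>H. \<forall>E2\<in>H. \<forall>v1\<in>E1 - E2. \<forall>v2\<in>E2 - E1.
         (E1 - {v1}) \<union> {v2} \<in> H \<or> (E2 - {v2}) \<union> {v1} \<in> H))"
proof -
  have "finite V" and "H \<subseteq> Pow V"
    using assms(3) by (auto simp: k_hypergraph_def nsets_def)
  then show ?thesis
    unfolding not_exchangeable_iff[OF assms(3)]
    by (simp only: monotone_hypergraph_2_iff_exchange simp_thms)
qed

end
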